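(* For each integer $r \ge 3$ and each integer $k \ge 0$, \[ \ln s_k(n,r) \le Q^{-1}\binom{n}{r-1}\bigl(\ln N + 1 - Q + o(1)\bigr) \qquad \text{as } n \to \infty, \] where $N = \binom{n-r+1}{k+1}$ and $Q = \binom{r+k}{k+1}$.
   Context: A matroid of rank $r$ on ground set $E$ is paving if every subset $F\subseteq E$ with $|F|<r$ is independent. $s_k(n,r)$ denotes the number of paving matroids of rank $r$ on the ground set $[n]=\{1,\dots,n\}$ all of whose hyperplanes have cardinality $r-1$ or $r+k$ (equivalently, every dependent hyperplane has cardinality $r+k$). *)

theory Defs
  imports Complex_Main "HOL-Library.Landau_Symbols"
begin

locale matroid =
  fixes E :: "'a set" and indep :: "'a set set"
  assumes finite_ground: "finite E"
    and indep_subset: "X \<in> indep \<Longrightarrow> X \<subseteq> E"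
    and indep_empty: "{} \<in> indep"
    and indep_hereditary: "X \<in> indep \<Longrightarrow> Y \<subseteq> X \<Longrightarrow> Y \<in> indep"
    and indep_augment:
      "X \<in> indep \<Longrightarrow> Y \<in> indep \<Longrightarrow> card X < card Y \<Longrightarrow> \<exists>y\<in>Y - X. insert y X \<in> indep"

definition matroid_rank :: "'a set set \<Rightarrow> 'a set \<Rightarrow> nat" where
  "matroid_rank indep A = Max (card ` {X \<in> indep. X \<subseteq> A})"

definition matroid_flat :: "'a set \<Rightarrow> 'a set set \<Rightarrow> 'a set \<Rightarrow> bool" where
  "matroid_flat E indep F \<longleftrightarrow>
     F \<subseteq> E \<and> (\<forall>e\<in>E - F. matroid_rank indep F < matroid_rank indep (insert e F))"

definition matroid_hyperplane :: "'a set \<Rightarrow> 'a set set \<Rightarrow> 'a set \<Rightarrow> bool" where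
  "matroid_hyperplane E indep H \<longleftrightarrow>
     matroid_flat E indep H \<and> matroid_rank indep H + 1 = matroid_rank indep E"

definition paving_matroid :: "'a set \<Rightarrow> 'a set set \<Rightarrow> bool" where
  "paving_matroid E indep \<longleftrightarrow>
     matroid E indep \<and> (\<forall>F\<subseteq>E. card F < matroid_rank indep E \<longrightarrow> F \<in> indep)"

definition s_paving :: "nat \<Rightarrow> nat \<Rightarrow> nat \<Rightarrow> nat" where
  "s_paving k n r =
     card {indep. paving_matroid {1..n} indep \<and> matroid_rank indep {1..n} = r \<and>
                  (\<forall>H. matroid_hyperplane {1..n} indep H \<longrightarrow>
                       card H = r - 1 \<or> card H = r + k)}"

end

theory Submission
  imports Defs "HOL-Real_Asymp.Real_Asymp"
begin

text \<open>
  The hyperplanes of size \<open>b = r + k\<close> determine the matroid, and any two of them share fewer than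
  \<open>t = r - 1\<close> points, so it suffices to count packings of \<open>b\<close>-subsets of \<open>{1..n}\<close> in which every
  \<open>t\<close>-subset is covered at most once.

  Packings of size \<open>m\<close> are counted by choosing the blocks one after another. The product over the
  steps of the reciprocals of the numbers of admissible choices is a sub-probability distribution on
  ordered packings. Averaging over all orderings of a fixed packing and applying Jensen's inequality
  twice, the number of packings times \<open>m!\<close> is at most the product over \<open>i < m\<close> of bounds on the mean
  number of blocks compatible with a random \<open>i\<close>-subset of the packing. A typical block
  conflicts with \<open>Q = b choose t\<close> members of a nearly perfect packing, so this mean is about
  \<open>(n choose b) * (1 - i / m) ^ Q\<close>. The sum of the logarithms of the last factors is about
  \<open>- Q * m\<close>, which together with \<open>ln (m!)\<close>, about \<open>m * ln m - m\<close>, yields the constant \<open>1 - Q\<close>.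
\<close>

section \<open>Counting conflict-free sets by ordered choice\<close>

text \<open>Jensen's inequality for the concave \<open>ln\<close>, proved by the tangent at
  \<open>\<alpha>\<close>. It serves twice: over the last element of an ordering, and over the
  \<open>i\<close>-subsets of a fixed conflict-free set.\<close>

lemma sum_ln_le_card_mult_ln:
  fixes f :: "'a \<Rightarrow> real"
  assumes "\<And>x. x \<in> S \<Longrightarrow> f x > 0" and "\<alpha> > 0" and "sum f S \<le> real (card S) * \<alpha>"
  shows "(\<Sum>x\<in>S. ln (f x)) \<le> real (card S) * ln \<alpha>"
proof -
  have "ln (f x) \<le> ln \<alpha> + (f x / \<alpha> - 1)" if "x \<in> S" for x
    using ln_le_minus_one[of "f x / \<alpha>"] assms(1)[OF that] \<open>\<alpha> > 0\<close> by (simp add: ln_div)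
  then have "(\<Sum>x\<in>S. ln (f x)) \<le> (\<Sum>x\<in>S. ln \<alpha> + (f x / \<alpha> - 1))"
    by (rule sum_mono)
  also have "\<dots> = real (card S) * ln \<alpha> + (sum f S / \<alpha> - real (card S))"
    by (simp add: sum.distrib sum_subtractf sum_divide_distrib)
  also have "sum f S / \<alpha> \<le> real (card S)"
    using assms(2,3) by (simp add: divide_le_eq)
  finally show ?thesis by simp
qed

text \<open>Double counting of pairs \<open>(x, S)\<close>: an \<open>i\<close>-subset survives the
  deletion of \<open>Suc m - i\<close> points. So a random \<open>i\<close>-subset left after
  deleting a random point is a uniformly random \<open>i\<close>-subset of \<open>I\<close>.\<close>

lemma sum_subsets_of_deletions:
  fixes f :: "'a set \<Rightarrow> real"
  assumes "finite I" and "card I = Suc m" and "i \<le> m"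
  shows "(\<Sum>x\<in>I. (\<Sum>S | S \<subseteq> I - {x} \<and> card S = i. f S) / real (m choose i)) / real (Suc m)
       = (\<Sum>S | S \<subseteq> I \<and> card S = i. f S) / real (Suc m choose i)"
proof -
  let ?D = "\<lambda>J. {S. S \<subseteq> J \<and> card S = i}"
  have fin: "finite (?D I)" using \<open>finite I\<close> by simp
  have "(\<Sum>x\<in>I. \<Sum>S\<in>?D (I - {x}). f S) = (\<Sum>x\<in>I. \<Sum>S | S \<in> ?D I \<and> x \<notin> S. f S)"
    by (intro sum.cong) auto
  also have "\<dots> = (\<Sum>S\<in>?D I. \<Sum>x | x \<in> I \<and> x \<notin> S. f S)"
    using assms(1) fin by (rule sum.swap_restrict)
  also have "\<dots> = (\<Sum>S\<in>?D I. real (Suc m - i) * f S)"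
  proof (intro sum.cong refl)
    fix S assume S: "S \<in> ?D I"
    have "card {x. x \<in> I \<and> x \<notin> S} = card (I - S)" by (simp add: set_diff_eq)
    also have "\<dots> = Suc m - i"
      using S assms(1,2) by (auto simp: card_Diff_subset finite_subset)
    finally show "(\<Sum>x | x \<in> I \<and> x \<notin> S. f S) = real (Suc m - i) * f S" by simp
  qed
  finally have *: "(\<Sum>x\<in>I. \<Sum>S\<in>?D (I - {x}). f S) = real (Suc m - i) * sum f (?D I)"
    by (simp add: sum_distrib_left)
  have "(Suc m - i) * (Suc m choose i) = Suc m * (m choose i)"
    using binomial_absorb_comp[of "Suc m" i] by simp
  then have **: "real (Suc m - i) * real (Suc m choose i) = real (Suc m) * real (m choose i)"
    by (metis of_nat_mult)
  have pos: "real (Suc m choose i) > 0" "real (m choose i) > 0"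
    using assms(3) by simp_all
  have "(\<Sum>x\<in>I. (\<Sum>S\<in>?D (I - {x}). f S) / real (m choose i)) / real (Suc m)
      = real (Suc m - i) * sum f (?D I) / (real (Suc m) * real (m choose i))"
    by (simp add: sum_divide_distrib[symmetric] * mult.commute)
  also have "\<dots> = sum f (?D I) / real (Suc m choose i)"
    unfolding **[symmetric] using pos assms(3)
    by (subst mult_divide_mult_cancel_left) simp_all
  finally show ?thesis .
qed

text \<open>Elements of \<open>S\<close> are excluded through \<open>C\<close> itself, which is
  assumed reflexive on \<open>X\<close> where choices are counted; hence also the condition
  \<open>x \<noteq> y\<close> in \<open>conflict_free\<close>.\<close>

definition available :: "'a set \<Rightarrow> ('a \<Rightarrow> 'a \<Rightarrow> bool) \<Rightarrow> 'a set \<Rightarrow> 'a set" where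
  "available X C S = {x \<in> X. \<forall>s\<in>S. \<not> C x s}"

definition conflict_free :: "'a set \<Rightarrow> ('a \<Rightarrow> 'a \<Rightarrow> bool) \<Rightarrow> nat \<Rightarrow> 'a set set" where
  "conflict_free X C m = {I. I \<subseteq> X \<and> card I = m \<and> (\<forall>x\<in>I. \<forall>y\<in>I. x \<noteq> y \<longrightarrow> \<not> C x y)}"

text \<open>For \<open>f S = ln (card (available X C S))\<close> this is the logarithm of the number of orderings
  of \<open>I\<close> minus the mean, over these orderings, of the total log-number of choices met when the
  elements of \<open>I\<close> are picked one by one: the first \<open>i\<close> elements of a random ordering
  form a uniformly random \<open>i\<close>-subset.\<close>

definition log_weight :: "('a set \<Rightarrow> real) \<Rightarrow> nat \<Rightarrow> 'a set \<Rightarrow> real" where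
  "log_weight f m I =
     ln (fact m) - (\<Sum>i<m. (\<Sum>S | S \<subseteq> I \<and> card S = i. f S) / real (m choose i))"

text \<open>Condition on the last element \<open>x\<close> of a random ordering: it is uniform in
  \<open>I\<close>, the earlier elements form a random ordering of \<open>I - {x}\<close>, and the
  last choice costs \<open>f (I - {x})\<close>.\<close>

lemma log_weight_Suc:
  assumes "finite I" and "card I = Suc m"
  shows "log_weight f (Suc m) I
       = ln (real (Suc m)) + (\<Sum>x\<in>I. log_weight f m (I - {x}) - f (I - {x})) / real (Suc m)"
proof -
  let ?a = "\<lambda>J i. (\<Sum>S | S \<subseteq> J \<and> card S = i. f S)"
  \<comment> \<open>The cost of the last choice is the missing term \<open>i = m\<close> for
    \<open>I - {x}\<close>, whose only \<open>m\<close>-subset is itself.\<close>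
  have last: "f (I - {x}) = ?a (I - {x}) m / real (m choose m)" if "x \<in> I" for x
  proof -
    have "card (I - {x}) = m" "finite (I - {x})" using assms that by auto
    then have "S = I - {x}" if "S \<subseteq> I - {x}" "card S = m" for S
      using that by (simp add: card_subset_eq)
    with \<open>card (I - {x}) = m\<close> have "{S. S \<subseteq> I - {x} \<and> card S = m} = {I - {x}}"
      by blast
    then show ?thesis by simp
  qed
  have "(\<Sum>x\<in>I. log_weight f m (I - {x}) - f (I - {x}))
      = (\<Sum>x\<in>I. ln (fact m) - (\<Sum>i<Suc m. ?a (I - {x}) i / real (m choose i)))"
    using last by (intro sum.cong) (auto simp: log_weight_def)
  also have "\<dots> = real (Suc m) * ln (fact m) - (\<Sum>x\<in>I. \<Sum>i<Suc m. ?a (I - {x}) i / real (m choose i))"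
    using assms by (simp only: sum_subtractf) simp
  also have "(\<Sum>x\<in>I. \<Sum>i<Suc m. ?a (I - {x}) i / real (m choose i))
           = (\<Sum>i<Suc m. \<Sum>x\<in>I. ?a (I - {x}) i / real (m choose i))"
    by (rule sum.swap)
  also have "\<dots> = (\<Sum>i<Suc m. real (Suc m) * (?a I i / real (Suc m choose i)))"
  proof (intro sum.cong refl)
    fix i assume "i \<in> {..<Suc m}"
    then have "i \<le> m" by simp
    show "(\<Sum>x\<in>I. ?a (I - {x}) i / real (m choose i)) = real (Suc m) * (?a I i / real (Suc m choose i))"
      unfolding sum_subsets_of_deletions[OF assms \<open>i \<le> m\<close>, symmetric] by simp
  qed
  also have "\<dots> = real (Suc m) * (\<Sum>i<Suc m. ?a I i / real (Suc m choose i))"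
    by (simp only: sum_distrib_left)
  finally have "(\<Sum>x\<in>I. log_weight f m (I - {x}) - f (I - {x})) / real (Suc m)
      = ln (fact m) - (\<Sum>i<Suc m. ?a I i / real (Suc m choose i))"
    by (simp only: right_diff_distrib[symmetric]) simp
  moreover have "ln (fact (Suc m) :: real) = ln (real (Suc m)) + ln (fact m)"
    by (simp only: fact_Suc of_nat_mult[symmetric]) (simp add: ln_mult)
  ultimately show ?thesis unfolding log_weight_def by linarith
qed

lemma conflict_free_finite:
  assumes "finite X"
  shows "finite (conflict_free X C m)"
  by (rule finite_subset[of _ "Pow X"]) (use assms in \<open>auto simp: conflict_free_def\<close>)

lemma conflict_free_delete_available:
  assumes "I \<in> conflict_free X C (Suc m)" and "x \<in> I" and "\<And>x. x \<in> X \<Longrightarrow> C x x"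
  shows "I - {x} \<in> conflict_free X C m" and "x \<in> available X C (I - {x})"
  using assms by (auto simp: conflict_free_def available_def)

text \<open>The recursion for \<open>log_weight\<close> makes the left side \<open>Suc m\<close>
  times the geometric mean of the \<open>Suc m\<close> summands on the right, which is at most their
  sum by Jensen.\<close>

lemma exp_log_weight_le:
  assumes "finite X" and refl: "\<And>x. x \<in> X \<Longrightarrow> C x x" and I: "I \<in> conflict_free X C (Suc m)"
  defines "A \<equiv> \<lambda>S. real (card (available X C S))"
  shows "exp (log_weight (\<lambda>S. ln (A S)) (Suc m) I)
      \<le> (\<Sum>x\<in>I. exp (log_weight (\<lambda>S. ln (A S)) m (I - {x})) / A (I - {x}))"
proof -
  let ?w = "log_weight (\<lambda>S. ln (A S))"
  let ?y = "\<lambda>x. exp (?w m (I - {x})) / A (I - {x})"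
  have cI: "card I = Suc m" and finI: "finite I" and ne: "I \<noteq> {}"
    using I assms(1) by (auto simp: conflict_free_def finite_subset)
  have Apos: "A (I - {x}) > 0" if "x \<in> I" for x
  proof -
    have "finite (available X C (I - {x}))" using assms(1) by (simp add: available_def)
    then show ?thesis
      using conflict_free_delete_available(2)[of I X C, OF I that refl]
      by (auto simp: A_def card_gt_0_iff)
  qed
  define s where "s = sum ?y I"
  have spos: "s > 0" unfolding s_def using finI ne Apos by (intro sum_pos) auto
  have "?w (Suc m) I = ln (real (Suc m)) + (\<Sum>x\<in>I. ln (?y x)) / real (Suc m)"
    unfolding log_weight_Suc[OF finI cI] using Apos
    by (intro arg_cong2[where f = "(+)"] arg_cong2[where f = "(/)"] sum.cong HOL.refl)
      (metis exp_gt_zero ln_div ln_exp order_less_irrefl)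
  also have "(\<Sum>x\<in>I. ln (?y x)) \<le> real (card I) * ln (s / real (Suc m))"
    by (rule sum_ln_le_card_mult_ln) (use Apos spos cI in \<open>auto simp: s_def\<close>)
  finally have "?w (Suc m) I \<le> ln (real (Suc m)) + ln (s / real (Suc m))"
    by (simp add: cI divide_right_mono)
  also have "\<dots> = ln s" using spos by (simp add: ln_div)
  finally show ?thesis using spos unfolding s_def by (simp add: ln_ge_iff)
qed

text \<open>Induction: the weight of each \<open>m\<close>-set \<open>J\<close> is split evenly
  among its available extensions, and the pieces arriving at a set \<open>I\<close> bound the weight
  of \<open>I\<close>.\<close>

lemma sum_exp_log_weight_le_1:
  assumes "finite X" and refl: "\<And>x. x \<in> X \<Longrightarrow> C x x"
  defines "A \<equiv> \<lambda>S. real (card (available X C S))"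
  shows "(\<Sum>I\<in>conflict_free X C m. exp (log_weight (\<lambda>S. ln (A S)) m I)) \<le> 1"
proof (induction m)
  case 0
  have "conflict_free X C 0 \<subseteq> {{}}" using assms(1) by (auto simp: conflict_free_def finite_subset)
  then have "(\<Sum>I\<in>conflict_free X C 0. exp (log_weight (\<lambda>S. ln (A S)) 0 I))
      \<le> (\<Sum>I\<in>{{}}. exp (log_weight (\<lambda>S. ln (A S)) 0 I))"
    by (intro sum_mono2) auto
  then show ?case by (simp add: log_weight_def)
next
  case (Suc m)
  let ?w = "log_weight (\<lambda>S. ln (A S))"
  let ?F = "conflict_free X C"
  let ?P = "Sigma (?F (Suc m)) (\<lambda>I. I)" and ?R = "Sigma (?F m) (available X C)"
  have fin: "finite (available X C S)" for S using assms(1) by (simp add: available_def)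
  have finI: "finite I" if "I \<in> ?F l" for I l
    using that assms(1) by (auto simp: conflict_free_def finite_subset)
  have finR: "finite ?R" using conflict_free_finite[OF assms(1)] fin by blast
  \<comment> \<open>Recording the deleted element makes deletion injective.\<close>
  define g where "g = (\<lambda>(I, x). (I - {x}, x :: 'a))"
  have inj: "inj_on g ?P" by (auto simp: inj_on_def g_def)
  have img: "g ` ?P \<subseteq> ?R"
    by (auto simp: g_def intro!: conflict_free_delete_available refl)
  have "(\<Sum>I\<in>?F (Suc m). exp (?w (Suc m) I))
      \<le> (\<Sum>I\<in>?F (Suc m). \<Sum>x\<in>I. exp (?w m (I - {x})) / A (I - {x}))"
    unfolding A_def by (intro sum_mono exp_log_weight_le assms(1) refl)
  also have "\<dots> = (\<Sum>(I, x)\<in>?P. exp (?w m (I - {x})) / A (I - {x}))"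
    using conflict_free_finite[OF assms(1)] finI by (intro sum.Sigma) auto
  also have "\<dots> = (\<Sum>(J, x)\<in>g ` ?P. exp (?w m J) / A J)"
    by (subst sum.reindex[OF inj]) (auto simp: g_def intro!: sum.cong)
  also have "\<dots> \<le> (\<Sum>(J, x)\<in>?R. exp (?w m J) / A J)"
    by (intro sum_mono2 finR img) (auto simp: A_def)
  also have "\<dots> = (\<Sum>J\<in>?F m. \<Sum>x\<in>available X C J. exp (?w m J) / A J)"
    using conflict_free_finite[OF assms(1)] fin by (intro sum.Sigma[symmetric]) auto
  \<comment> \<open>The inner sum is \<open>exp (?w m J)\<close>, except that it is 0 when nothing
    is available.\<close>
  also have "\<dots> \<le> (\<Sum>J\<in>?F m. exp (?w m J))"
    by (intro sum_mono) (auto simp: A_def)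
  finally show ?case using Suc.IH by linarith
qed

text \<open>Jensen over the \<open>i\<close>-subsets bounds every log-weight below by the same
  \<open>b\<close>; since the total weight is at most 1, there are at most \<open>exp (- b)\<close>
  sets.\<close>

lemma card_conflict_free_le:
  assumes "finite X" and refl: "\<And>x. x \<in> X \<Longrightarrow> C x x"
    and \<alpha>: "\<And>i. i < m \<Longrightarrow> \<alpha> i > 0"
    and avg: "\<And>I i. I \<in> conflict_free X C m \<Longrightarrow> i < m \<Longrightarrow>
      (\<Sum>S | S \<subseteq> I \<and> card S = i. real (card (available X C S))) \<le> real (m choose i) * \<alpha> i"
  shows "real (card (conflict_free X C m)) \<le> exp ((\<Sum>i<m. ln (\<alpha> i)) - ln (fact m))"
proof -
  define A where "A = (\<lambda>S. real (card (available X C S)))"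
  let ?w = "log_weight (\<lambda>S. ln (A S))"
  define b where "b = ln (fact m) - (\<Sum>i<m. ln (\<alpha> i))"
  have "b \<le> ?w m I" if I: "I \<in> conflict_free X C m" for I
  proof -
    have finI: "finite I" and cI: "card I = m" using I assms(1) by (auto simp: conflict_free_def finite_subset)
    have "(\<Sum>S | S \<subseteq> I \<and> card S = i. ln (A S)) / real (m choose i) \<le> ln (\<alpha> i)" if i: "i < m" for i
    proof -
      let ?D = "{S. S \<subseteq> I \<and> card S = i}"
      have cD: "card ?D = m choose i" using n_subsets[OF finI] cI by simp
      \<comment> \<open>As \<open>i < m\<close>, some element of \<open>I\<close> lies outside
        \<open>S\<close> and is available, so the logarithm has a positive argument.\<close>
      have "A S > 0" if S: "S \<in> ?D" for S
      proof -
        have "S \<noteq> I" using S i cI by auto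
        then obtain x where "x \<in> I" "x \<notin> S" using S by blast
        then have "x \<in> available X C S"
          using I S unfolding conflict_free_def available_def mem_Collect_eq by (metis subsetD)
        moreover have "finite (available X C S)" using assms(1) by (simp add: available_def)
        ultimately show ?thesis by (auto simp: A_def card_gt_0_iff)
      qed
      then have "(\<Sum>S\<in>?D. ln (A S)) \<le> real (card ?D) * ln (\<alpha> i)"
        by (rule sum_ln_le_card_mult_ln) (use avg[OF I i] \<alpha>[OF i] cD in \<open>auto simp: A_def\<close>)
      moreover have "real (m choose i) > 0" using i by simp
      ultimately show ?thesis by (simp add: cD divide_le_eq mult.commute)
    qed
    then show ?thesis unfolding b_def log_weight_def by (auto intro!: sum_mono)
  qed
  then have "real (card (conflict_free X C m)) * exp b \<le> (\<Sum>I\<in>conflict_free X C m. exp (?w m I))"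
    by (intro sum_bounded_below[THEN order.trans[rotated]]) auto
  also have "\<dots> \<le> 1" unfolding A_def by (intro sum_exp_log_weight_le_1 assms(1) refl)
  finally have "real (card (conflict_free X C m)) \<le> 1 / exp b" by (simp add: le_divide_eq)
  also have "1 / exp b = exp (- b)" by (simp add: exp_minus inverse_eq_divide)
  finally show ?thesis by (simp add: b_def)
qed

text \<open>A random \<open>i\<close>-subset of \<open>m\<close> points avoids \<open>d\<close>
  given ones with probability at most \<open>(1 - i / m) ^ d\<close>. Each induction step multiplies
  the ratio of binomials by \<open>(Suc l - i) / Suc l\<close>, which is at most
  \<open>(m - i) / m\<close>.\<close>

lemma choose_diff_le:
  assumes "i \<le> m"
  shows "real ((m - d) choose i) * real m ^ d \<le> real (m choose i) * real (m - i) ^ d"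
proof (induction d)
  case (Suc d)
  show ?case
  proof (cases "d < m \<and> i \<le> m - Suc d")
    case False
    \<comment> \<open>With truncated subtraction the left binomial vanishes here unless
      \<open>i = 0\<close>.\<close>
    then have "i > m - Suc d \<or> m = 0 \<or> i = 0" by auto
    then show ?thesis using assms by (auto simp: binomial_eq_0)
  next
    case True
    define l where "l = m - Suc d"
    have l: "m - d = Suc l" "m = l + Suc d" "i \<le> l" using True by (auto simp: l_def)
    have "(Suc l - i) * (Suc l choose i) = Suc l * (l choose i)"
      using binomial_absorb_comp[of "Suc l" i] by simp
    then have 1: "real (Suc l - i) * real (Suc l choose i) = real (Suc l) * real (l choose i)"
      by (metis of_nat_mult)
    obtain j where j: "l = i + j" using l(3) le_Suc_ex by blast
    have "Suc j * m \<le> (j + Suc d) * Suc l" unfolding l(2) j by (simp add: algebra_simps)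
    then have 2: "real (Suc l - i) * real m \<le> real (m - i) * real (Suc l)"
      unfolding of_nat_mult[symmetric] of_nat_le_iff using l(2) j by simp
    have "real (Suc l) * (real (l choose i) * real m ^ Suc d)
        = (real (Suc l - i) * real m) * (real (Suc l choose i) * real m ^ d)"
      using 1 by (simp add: algebra_simps)
    also have "\<dots> \<le> (real (m - i) * real (Suc l)) * (real (m choose i) * real (m - i) ^ d)"
      by (rule mult_mono[OF 2 Suc.IH[unfolded l(1)]]) auto
    finally have "real (Suc l) * (real (l choose i) * real m ^ Suc d)
       \<le> real (Suc l) * (real (m choose i) * real (m - i) ^ Suc d)"
      by (simp add: algebra_simps)
    then show ?thesis unfolding l_def[symmetric]
      by (rule mult_left_le_imp_le) simp
  qed
qed simp

text \<open>Exchange of summation: for each \<open>x\<close>, count the \<open>i\<close>-subsets of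
  \<open>I\<close> that avoid its conflicts. At least \<open>Q\<close> conflicts give the factor
  \<open>(1 - i / m) ^ Q\<close>; the few other \<open>x\<close> are charged with all
  \<open>i\<close>-subsets, which gives \<open>\<eta>\<close>.\<close>

lemma sum_card_available_le:
  assumes "finite X" and I: "I \<in> conflict_free X C m" and "i < m"
    and bad: "real (card {x \<in> X. card {s \<in> I. C x s} < Q}) \<le> \<eta> * real (card X)"
  shows "(\<Sum>S | S \<subseteq> I \<and> card S = i. real (card (available X C S)))
      \<le> real (m choose i) * (real (card X) * ((real (m - i) / real m) ^ Q + \<eta>))"
proof -
  have finI: "finite I" and cI: "card I = m" using I assms(1) by (auto simp: conflict_free_def finite_subset)
  let ?D = "{S. S \<subseteq> I \<and> card S = i}" and ?B = "{x \<in> X. card {s \<in> I. C x s} < Q}"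
  let ?p = "(real (m - i) / real m) ^ Q"
  have "(\<Sum>S\<in>?D. real (card (available X C S))) = (\<Sum>S\<in>?D. \<Sum>x | x \<in> X \<and> (\<forall>s\<in>S. \<not> C x s). 1)"
    by (simp add: available_def)
  also have "\<dots> = (\<Sum>x\<in>X. \<Sum>S | S \<in> ?D \<and> (\<forall>s\<in>S. \<not> C x s). 1)"
    by (rule sum.swap_restrict) (use finI assms(1) in auto)
  also have "\<dots> \<le> (\<Sum>x\<in>X. real (m choose i) * ?p + (if x \<in> ?B then real (m choose i) else 0))"
  proof (rule sum_mono)
    fix x assume x: "x \<in> X"
    let ?d = "card {s \<in> I. C x s}"
    have "{S. S \<in> ?D \<and> (\<forall>s\<in>S. \<not> C x s)} = {S. S \<subseteq> I - {s \<in> I. C x s} \<and> card S = i}" by auto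
    moreover have "card (I - {s \<in> I. C x s}) = m - ?d"
      using finI cI by (subst card_Diff_subset) auto
    ultimately have eq: "(\<Sum>S | S \<in> ?D \<and> (\<forall>s\<in>S. \<not> C x s). 1) = real ((m - ?d) choose i)"
      using n_subsets[of "I - {s \<in> I. C x s}" i] finI by simp
    show "(\<Sum>S | S \<in> ?D \<and> (\<forall>s\<in>S. \<not> C x s). 1)
        \<le> real (m choose i) * ?p + (if x \<in> ?B then real (m choose i) else 0)"
    proof (cases "x \<in> ?B")
      case True
      have "(m - ?d) choose i \<le> m choose i" by (rule binomial_right_mono) simp
      then show ?thesis unfolding eq using True by (simp add: add_increasing)
    next
      case False
      then have "(m - ?d) choose i \<le> (m - Q) choose i" using x by (intro binomial_right_mono) auto
      moreover have "real ((m - Q) choose i) \<le> real (m choose i) * ?p"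
        using choose_diff_le[of i m Q] assms(3) by (simp add: power_divide le_divide_eq)
      ultimately show ?thesis unfolding eq using False by simp
    qed
  qed
  also have "\<dots> = real (card X) * (real (m choose i) * ?p) + real (card ?B) * real (m choose i)"
    using assms(1) by (simp add: sum.distrib sum.If_cases Int_def)
  also have "\<dots> \<le> real (card X) * (real (m choose i) * ?p) + (\<eta> * real (card X)) * real (m choose i)"
    using bad by (intro add_left_mono mult_right_mono) auto
  also have "\<dots> = real (m choose i) * (real (card X) * (?p + \<eta>))" by (simp add: algebra_simps)
  finally show ?thesis .
qed

lemma card_conflict_free_le_exp:
  assumes "finite X" and "X \<noteq> {}" and refl: "\<And>x. x \<in> X \<Longrightarrow> C x x" and "\<eta> \<ge> 0"
    and bad: "\<And>I. I \<in> conflict_free X C m \<Longrightarrow>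
      real (card {x \<in> X. card {s \<in> I. C x s} < Q}) \<le> \<eta> * real (card X)"
  shows "real (card (conflict_free X C m))
     \<le> exp (real m * ln (real (card X)) + (\<Sum>i<m. ln ((real (m - i) / real m) ^ Q + \<eta>)) - ln (fact m))"
proof -
  have Xpos: "real (card X) > 0" using assms(1,2) by (simp add: card_gt_0_iff)
  have pos: "(real (m - i) / real m) ^ Q + \<eta> > 0" if "i < m" for i
    using that \<open>\<eta> \<ge> 0\<close> by (intro add_pos_nonneg zero_less_power divide_pos_pos) auto
  have "real (card (conflict_free X C m))
      \<le> exp ((\<Sum>i<m. ln (real (card X) * ((real (m - i) / real m) ^ Q + \<eta>))) - ln (fact m))"
    by (intro card_conflict_free_le sum_card_available_le assms(1) refl bad mult_pos_pos Xpos pos)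
  also have "(\<Sum>i<m. ln (real (card X) * ((real (m - i) / real m) ^ Q + \<eta>)))
      = (\<Sum>i<m. ln (real (card X)) + ln ((real (m - i) / real m) ^ Q + \<eta>))"
    using Xpos pos by (intro sum.cong refl ln_mult_pos) simp_all
  finally show ?thesis by (simp add: sum.distrib)
qed

section \<open>Packings\<close>

abbreviation subsets_of_card :: "'a set \<Rightarrow> nat \<Rightarrow> 'a set set" where
  "subsets_of_card E b \<equiv> {B. B \<subseteq> E \<and> card B = b}"

text \<open>Finite blocks conflict when they share a \<open>t\<close>-subset, and a block conflicts
  with itself as soon as \<open>t \<le> b\<close>, which gives the reflexivity required for
  counting.\<close>

abbreviation packings :: "'a set \<Rightarrow> nat \<Rightarrow> nat \<Rightarrow> nat \<Rightarrow> 'a set set set" where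
  "packings E t b \<equiv> conflict_free (subsets_of_card E b) (\<lambda>B B'. t \<le> card (B \<inter> B'))"

lemma card_supersets_le:
  assumes "finite E" and "T \<subseteq> E"
  shows "card {B \<in> subsets_of_card E b. T \<subseteq> B} \<le> (card E - card T) choose (b - card T)"
proof -
  have fin: "finite T" using assms finite_subset by blast
  have "inj_on (\<lambda>B. B - T) {B \<in> subsets_of_card E b. T \<subseteq> B}"
    by (auto simp: inj_on_def)
  moreover have "(\<lambda>B. B - T) ` {B \<in> subsets_of_card E b. T \<subseteq> B} \<subseteq> subsets_of_card (E - T) (b - card T)"
    using fin by (auto simp: card_Diff_subset)
  moreover have "finite (subsets_of_card (E - T) (b - card T))" using assms(1) by simp
  ultimately have "card {B \<in> subsets_of_card E b. T \<subseteq> B} \<le> card (subsets_of_card (E - T) (b - card T))"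
    by (rule card_inj_on_le)
  also have "\<dots> = (card E - card T) choose (b - card T)"
    using assms fin by (simp add: n_subsets card_Diff_subset)
  finally show ?thesis .
qed

text \<open>Distinct members share fewer than \<open>t\<close> points, so their families of
  \<open>t\<close>-subsets are disjoint.\<close>

lemma card_covered:
  assumes "finite E" and I: "I \<in> packings E t b m"
  shows "card (\<Union>B\<in>I. subsets_of_card B t) = m * (b choose t)"
proof -
  have IX: "I \<subseteq> subsets_of_card E b" and cI: "card I = m"
    and pw: "\<And>B B'. B \<in> I \<Longrightarrow> B' \<in> I \<Longrightarrow> B \<noteq> B' \<Longrightarrow> card (B \<inter> B') < t"
    using I by (auto simp: conflict_free_def not_le)
  have finI: "finite I" by (rule finite_subset[OF IX]) (use assms(1) in simp)
  have finB: "finite B" if "B \<in> I" for B using that IX assms(1) finite_subset by blast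
  have "card (\<Union>B\<in>I. subsets_of_card B t) = (\<Sum>B\<in>I. card (subsets_of_card B t))"
  proof (intro card_UN_disjoint finI ballI impI)
    fix B B' assume B: "B \<in> I" "B' \<in> I" "B \<noteq> B'"
    have False if "T \<subseteq> B" "T \<subseteq> B'" "card T = t" for T
      using card_mono[of "B \<inter> B'" T] pw[OF B] that finB[OF B(1)] by simp
    then show "subsets_of_card B t \<inter> subsets_of_card B' t = {}" by auto
  qed (use finB in simp)
  also have "\<dots> = (\<Sum>B\<in>I. b choose t)"
    using IX finB by (intro sum.cong refl) (auto simp: n_subsets)
  finally show ?thesis by (simp add: cI)
qed

lemma packing_size_le:
  assumes "finite E" and I: "I \<in> packings E t b m"
  shows "m * (b choose t) \<le> card E choose t"
proof -
  have "(\<Union>B\<in>I. subsets_of_card B t) \<subseteq> subsets_of_card E t"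
    using I by (auto simp: conflict_free_def)
  then have "card (\<Union>B\<in>I. subsets_of_card B t) \<le> card (subsets_of_card E t)"
    using assms(1) by (intro card_mono) simp_all
  then show ?thesis using card_covered[OF assms] assms(1) by (simp add: n_subsets)
qed

text \<open>A block whose \<open>t\<close>-subsets are all covered by the packing, no two of them by the same member,
  conflicts with \<open>b choose t\<close> members. The two summands count the other blocks: those with an
  uncovered \<open>t\<close>-subset, and those meeting a member in more than \<open>t\<close> points.\<close>

lemma card_few_conflicts_le:
  assumes "finite E" and I: "I \<in> packings E t b m"
  shows "card {B \<in> subsets_of_card E b. card {B' \<in> I. t \<le> card (B \<inter> B')} < b choose t}
    \<le> ((card E choose t) - m * (b choose t)) * ((card E - t) choose (b - t))
      + m * ((b choose Suc t) * ((card E - Suc t) choose (b - Suc t)))"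
proof -
  let ?X = "subsets_of_card E b"
  have IX: "I \<subseteq> subsets_of_card E b" and cI: "card I = m"
    using I by (auto simp: conflict_free_def)
  have finX: "finite ?X" using assms(1) by simp
  have finI: "finite I" by (rule finite_subset[OF IX finX])
  have finB: "finite B" if "B \<subseteq> E" for B using that assms(1) finite_subset by blast
  define U where "U = subsets_of_card E t - (\<Union>B\<in>I. subsets_of_card B t)"
  have cU: "card U = (card E choose t) - m * (b choose t)"
  proof -
    have "(\<Union>B\<in>I. subsets_of_card B t) \<subseteq> subsets_of_card E t" using IX by auto
    moreover have "finite (subsets_of_card E t)" using assms(1) by simp
    ultimately have "card U = card (subsets_of_card E t) - card (\<Union>B\<in>I. subsets_of_card B t)"
      unfolding U_def by (intro card_Diff_subset) (auto intro: finite_subset)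
    then show ?thesis using card_covered[OF assms] assms(1) by (simp add: n_subsets)
  qed
  have finU: "finite U" unfolding U_def using assms(1) by simp
  let ?up = "\<lambda>T. {B \<in> ?X. T \<subseteq> B}"
  let ?V = "\<Union>T\<in>U. ?up T" and ?W = "\<Union>B'\<in>I. \<Union>T\<in>subsets_of_card B' (Suc t). ?up T"
  have "{B \<in> ?X. card {B' \<in> I. t \<le> card (B \<inter> B')} < b choose t} \<subseteq> ?V \<union> ?W"
  proof (rule subsetI, rule ccontr)
    fix B assume B: "B \<in> {B \<in> ?X. card {B' \<in> I. t \<le> card (B \<inter> B')} < b choose t}"
      and nB: "B \<notin> ?V \<union> ?W"
    have BE: "B \<subseteq> E" "card B = b" using B by auto
    let ?K = "{B' \<in> I. t \<le> card (B \<inter> B')}"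
    have small: "card (B \<inter> B') \<le> t" if "B' \<in> I" for B'
    proof (rule ccontr)
      assume "\<not> card (B \<inter> B') \<le> t"
      then obtain T where "T \<subseteq> B \<inter> B'" "card T = Suc t"
        by (metis not_less_eq_eq obtain_subset_with_card_n)
      then have "B \<in> ?W" using that BE by blast
      then show False using nB by blast
    qed
    \<comment> \<open>A \<open>t\<close>-subset \<open>T\<close> of \<open>B\<close> is covered by
      some member \<open>B'\<close>, and as \<open>B \<inter> B'\<close> has at most
      \<open>t\<close> points it equals \<open>T\<close>. Thus \<open>B\<close> has at least
      \<open>b choose t\<close> conflicts.\<close>
    have "subsets_of_card B t \<subseteq> (\<lambda>B'. B \<inter> B') ` ?K"
    proof
      fix T assume T: "T \<in> subsets_of_card B t"
      have "T \<notin> U" using T nB BE by auto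
      then obtain B' where B': "B' \<in> I" "T \<subseteq> B'" using T BE unfolding U_def by blast
      have "T \<subseteq> B \<inter> B'" using T B' by auto
      moreover have fi: "finite (B \<inter> B')" using finB[OF BE(1)] by simp
      ultimately have "t \<le> card (B \<inter> B')" using T card_mono by force
      moreover have "T = B \<inter> B'"
        using T small[OF B'(1)] \<open>T \<subseteq> B \<inter> B'\<close> fi by (intro card_seteq) auto
      ultimately show "T \<in> (\<lambda>B'. B \<inter> B') ` ?K" using B'(1) by blast
    qed
    then have "card (subsets_of_card B t) \<le> card ?K"
      using finI by (intro surj_card_le) auto
    then show False using B finB[OF BE(1)] by (auto simp: n_subsets)
  qed
  moreover have "finite (?V \<union> ?W)" by (rule finite_subset[OF _ finX]) auto
  ultimately have "card {B \<in> ?X. card {B' \<in> I. t \<le> card (B \<inter> B')} < b choose t} \<le> card (?V \<union> ?W)"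
    by (intro card_mono)
  also have "\<dots> \<le> card ?V + card ?W" by (rule card_Un_le)
  also have "card ?V \<le> card U * ((card E - t) choose (b - t))"
  proof -
    have "card ?V \<le> (\<Sum>T\<in>U. card (?up T))" by (rule card_UN_le[OF finU])
    also have "\<dots> \<le> (\<Sum>T\<in>U. (card E - t) choose (b - t))"
      using card_supersets_le[OF assms(1)] by (intro sum_mono) (auto simp: U_def)
    finally show ?thesis by simp
  qed
  also have "card ?W \<le> m * ((b choose Suc t) * ((card E - Suc t) choose (b - Suc t)))"
  proof -
    have "card ?W \<le> (\<Sum>B'\<in>I. card (\<Union>T\<in>subsets_of_card B' (Suc t). ?up T))"
      by (rule card_UN_le[OF finI])
    also have "\<dots> \<le> (\<Sum>B'\<in>I. (b choose Suc t) * ((card E - Suc t) choose (b - Suc t)))"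
    proof (rule sum_mono)
      fix B' assume "B' \<in> I"
      then have B': "B' \<subseteq> E" "card B' = b" using IX by auto
      have "card (\<Union>T\<in>subsets_of_card B' (Suc t). ?up T)
          \<le> (\<Sum>T\<in>subsets_of_card B' (Suc t). card (?up T))"
        using finB[OF B'(1)] by (intro card_UN_le) simp
      also have "\<dots> \<le> (\<Sum>T\<in>subsets_of_card B' (Suc t). (card E - Suc t) choose (b - Suc t))"
      proof (rule sum_mono)
        fix T assume "T \<in> subsets_of_card B' (Suc t)"
        then show "card (?up T) \<le> (card E - Suc t) choose (b - Suc t)"
          using card_supersets_le[OF assms(1), of T b] B' by auto
      qed
      also have "\<dots> = (b choose Suc t) * ((card E - Suc t) choose (b - Suc t))"
        using n_subsets[OF finB[OF B'(1)], of "Suc t"] B' by simp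
      finally show "card (\<Union>T\<in>subsets_of_card B' (Suc t). ?up T)
          \<le> (b choose Suc t) * ((card E - Suc t) choose (b - Suc t))" .
    qed
    finally show ?thesis by (simp add: cI)
  qed
  finally show ?thesis by (simp add: cU)
qed

text \<open>Divides the preceding count by \<open>n choose b\<close>. Counting pairs of a
  \<open>t\<close>-set inside a \<open>b\<close>-set (\<open>TQ\<close>) turns the first summand
  into \<open>Q\<close> times the uncovered fraction; the second becomes of order
  \<open>1 / n\<close> for fixed \<open>b\<close> and \<open>t\<close>.\<close>

lemma few_conflicts_fraction_le:
  assumes "finite E" and n: "card E = n" and "t < b" and "b \<le> n" and I: "I \<in> packings E t b m"
  defines "Q \<equiv> b choose t"
  defines "\<eta> \<equiv> real Q * (1 - real m * real Q / real (n choose t))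
                + real (b choose Suc t) * real (b - t) / real (n - t)"
  shows "real (card {B \<in> subsets_of_card E b. card {B' \<in> I. t \<le> card (B \<inter> B')} < Q})
      \<le> \<eta> * real (card (subsets_of_card E b))"
proof -
  let ?V = "real (n choose t)" and ?T = "real (n choose b)" and ?N = "real ((n - t) choose (b - t))"
  let ?c = "real (b choose Suc t)" and ?M = "real ((n - Suc t) choose (b - Suc t))"
  have cX: "card (subsets_of_card E b) = n choose b" using assms(1) n by (simp add: n_subsets)
  have "(n choose b) * (b choose t) = (n choose t) * ((n - t) choose (b - t))"
    using choose_mult[of t b n] assms(3,4) by simp
  then have TQ: "?T * real Q = ?V * ?N" unfolding Q_def by (metis of_nat_mult)
  have Vpos: "?V > 0" using assms(3,4) by simp
  have npos: "real (n - t) > 0" using assms(3,4) by simp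
  have "(b - t) * ((n - t) choose (b - t)) = (n - t) * ((n - Suc t) choose (b - Suc t))"
    using binomial_absorption[of "b - Suc t" "n - t"] assms(3,4) by (simp add: Suc_diff_Suc)
  then have NM: "real (b - t) * ?N = real (n - t) * ?M" by (metis of_nat_mult)
  have mQ: "m * Q \<le> n choose t" using packing_size_le[OF assms(1) I] n by (simp add: Q_def)
  then have mQ': "real m * real Q \<le> ?V" by (metis of_nat_mult of_nat_le_iff)
  have "real (card {B \<in> subsets_of_card E b. card {B' \<in> I. t \<le> card (B \<inter> B')} < Q})
      \<le> real (((n choose t) - m * Q) * ((n - t) choose (b - t))
        + m * ((b choose Suc t) * ((n - Suc t) choose (b - Suc t))))"
    using card_few_conflicts_le[OF assms(1) I] n unfolding Q_def by (simp only: of_nat_le_iff)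
  also have "\<dots> = (?V - real m * real Q) * ?N + real m * ?c * ?M"
    using mQ by (simp add: of_nat_diff)
  also have "(?V - real m * real Q) * ?N = real Q * (1 - real m * real Q / ?V) * ?T"
  proof -
    have "real Q * (1 - real m * real Q / ?V) * ?T = (1 - real m * real Q / ?V) * (?V * ?N)"
      unfolding TQ[symmetric] by (simp add: ac_simps)
    also have "\<dots> = (?V - real m * real Q) * ?N" using Vpos by (simp add: field_simps)
    finally show ?thesis by simp
  qed
  \<comment> \<open>\<open>NM\<close> replaces \<open>?M\<close> by a multiple of \<open>?N\<close>;
    the bound \<open>real m * ?N \<le> ?T\<close> is \<open>mQ'\<close> rescaled by
    \<open>TQ\<close>.\<close>
  also have "real m * ?c * ?M \<le> ?c * real (b - t) / real (n - t) * ?T"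
  proof -
    have Qpos: "real Q > 0" using assms(3) by (simp add: Q_def)
    have "real m * ?N \<le> ?T"
    proof (rule mult_right_le_imp_le[OF _ Qpos])
      have "real m * ?N * real Q = (real m * real Q) * ?N" by simp
      also have "\<dots> \<le> ?V * ?N" using mQ' by (rule mult_right_mono) simp
      finally show "real m * ?N * real Q \<le> ?T * real Q" using TQ by simp
    qed
    then have "(?c * real (b - t) / real (n - t)) * (real m * ?N) \<le> (?c * real (b - t) / real (n - t)) * ?T"
      by (rule mult_left_mono) simp
    moreover have "(?c * real (b - t) / real (n - t)) * (real m * ?N) = real m * ?c * ?M"
    proof -
      have "(?c * real (b - t) / real (n - t)) * (real m * ?N)
          = ?c * real m * (real (b - t) * ?N) / real (n - t)" by simp
      also have "\<dots> = real m * ?c * ?M" unfolding NM using npos by simp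
      finally show ?thesis .
    qed
    ultimately show ?thesis by simp
  qed
  finally show ?thesis unfolding \<eta>_def cX by (simp add: distrib_right)
qed

section \<open>Paving matroids\<close>

context matroid
begin

lemma finite_indep_subsets: "finite {X \<in> indep. X \<subseteq> A}"
  by (rule finite_subset[of _ "Pow E"]) (use finite_ground indep_subset in auto)

lemma card_le_rank:
  assumes "X \<in> indep" and "X \<subseteq> A"
  shows "card X \<le> matroid_rank indep A"
  unfolding matroid_rank_def using assms finite_indep_subsets by (intro Max_ge) auto

lemma rank_attained: obtains X where "X \<in> indep" "X \<subseteq> A" "card X = matroid_rank indep A"
proof -
  have "matroid_rank indep A \<in> card ` {X \<in> indep. X \<subseteq> A}"
    unfolding matroid_rank_def using finite_indep_subsets indep_empty by (intro Max_in) auto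
  then show ?thesis using that by auto
qed

text \<open>A common subset \<open>F\<close> of size \<open>r - 1\<close> is independent because the
  matroid is paving. If some \<open>x\<close> of \<open>H\<close> were outside \<open>H'\<close>,
  then \<open>insert x H'\<close> would have full rank, and augmenting \<open>F\<close> within it
  would place an independent \<open>r\<close>-set inside \<open>H\<close> (if \<open>x\<close> is
  added) or inside \<open>H'\<close>.\<close>

lemma paving_hyperplane_subset:
  assumes "paving_matroid E indep" and r: "matroid_rank indep E = r" and "0 < r"
    and H: "matroid_hyperplane E indep H" and H': "matroid_hyperplane E indep H'"
    and inter: "r - 1 \<le> card (H \<inter> H')"
  shows "H \<subseteq> H'"
proof
  fix x assume x: "x \<in> H"
  have HE: "H \<subseteq> E" and rH: "matroid_rank indep H < r" "matroid_rank indep H' < r"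
    using H H' r by (auto simp: matroid_hyperplane_def matroid_flat_def)
  obtain F where F: "F \<subseteq> H \<inter> H'" "card F = r - 1" using inter by (metis obtain_subset_with_card_n)
  then have "F \<in> indep" using assms(1,3) r HE unfolding paving_matroid_def by auto
  show "x \<in> H'"
  proof (rule ccontr)
    assume nx: "x \<notin> H'"
    then have "x \<in> E - H'" using x HE by blast
    then have "matroid_rank indep H' < matroid_rank indep (insert x H')"
      using H' by (simp add: matroid_hyperplane_def matroid_flat_def)
    then have "r \<le> matroid_rank indep (insert x H')"
      using H' r by (simp add: matroid_hyperplane_def)
    then obtain Y where Y: "Y \<in> indep" "Y \<subseteq> insert x H'" "r \<le> card Y"
      using rank_attained by metis
    have "card F < card Y" using F(2) Y(3) \<open>0 < r\<close> by linarith
    then obtain y where y: "y \<in> Y - F" "insert y F \<in> indep"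
      using indep_augment[OF \<open>F \<in> indep\<close> Y(1)] by blast
    have "finite F" using F HE finite_ground by (meson finite_subset le_inf_iff)
    then have c: "card (insert y F) = r" using y F \<open>0 < r\<close> by auto
    show False
    proof (cases "y = x")
      case True
      then show False using card_le_rank[OF y(2), of H] F x c rH by auto
    next
      case False
      then show False using card_le_rank[OF y(2), of H'] F y Y c rH by auto
    qed
  qed
qed

text \<open>A maximal superset of \<open>D\<close> of the same rank is a flat, since each further
  point must raise the rank.\<close>

lemma dependent_subset_hyperplane:
  assumes "D \<subseteq> E" and "matroid_rank indep D + 1 = matroid_rank indep E"
  obtains H where "D \<subseteq> H" "matroid_hyperplane E indep H"
proof -
  let ?F = "{H. D \<subseteq> H \<and> H \<subseteq> E \<and> matroid_rank indep H = matroid_rank indep D}"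
  have "finite ?F" using finite_ground by simp
  moreover have "?F \<noteq> {}" using assms(1) by auto
  ultimately obtain H where H: "H \<in> ?F" and max: "\<forall>H'\<in>?F. H \<subseteq> H' \<longrightarrow> H = H'"
    using finite_has_maximal[of ?F] by auto
  have "matroid_rank indep H < matroid_rank indep (insert e H)" if e: "e \<in> E - H" for e
  proof (rule ccontr)
    assume "\<not> ?thesis"
    moreover obtain Z where "Z \<in> indep" "Z \<subseteq> H" "card Z = matroid_rank indep H" by (rule rank_attained)
    then have "matroid_rank indep H \<le> matroid_rank indep (insert e H)"
      using card_le_rank[of Z "insert e H"] by auto
    ultimately have "insert e H \<in> ?F" using H e by auto
    then show False using max e by blast
  qed
  then have "matroid_hyperplane E indep H"
    using H assms(2) by (auto simp: matroid_hyperplane_def matroid_flat_def)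
  then show ?thesis using that H by auto
qed

end

text \<open>A dependent \<open>r\<close>-set has rank \<open>r - 1\<close>, so it lies in a
  hyperplane with at least \<open>r\<close> points, which must have size \<open>b\<close>. Hence the
  hyperplanes of size \<open>b\<close> determine the matroid.\<close>

lemma paving_indep_iff:
  assumes pav: "paving_matroid E indep" and r: "matroid_rank indep E = r" and "0 < r"
    and hyp: "\<And>H. matroid_hyperplane E indep H \<Longrightarrow> card H = r - 1 \<or> card H = b"
  shows "Y \<in> indep \<longleftrightarrow> Y \<subseteq> E \<and> card Y \<le> r \<and>
    (card Y = r \<longrightarrow> \<not> (\<exists>H. matroid_hyperplane E indep H \<and> card H = b \<and> Y \<subseteq> H))"
proof
  interpret matroid E indep using pav by (simp add: paving_matroid_def)
  {
    assume Y: "Y \<in> indep"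
    have "\<not> Y \<subseteq> H" if "card Y = r" "matroid_hyperplane E indep H" for H
      using card_le_rank[OF Y, of H] that r by (auto simp: matroid_hyperplane_def)
    then show "Y \<subseteq> E \<and> card Y \<le> r \<and>
      (card Y = r \<longrightarrow> \<not> (\<exists>H. matroid_hyperplane E indep H \<and> card H = b \<and> Y \<subseteq> H))"
      using card_le_rank[OF Y, of E] indep_subset[OF Y] r by auto
  next
    assume Y: "Y \<subseteq> E \<and> card Y \<le> r \<and>
      (card Y = r \<longrightarrow> \<not> (\<exists>H. matroid_hyperplane E indep H \<and> card H = b \<and> Y \<subseteq> H))"
    show "Y \<in> indep"
    proof (rule ccontr)
      assume nY: "Y \<notin> indep"
      then have cY: "card Y = r" using Y pav r unfolding paving_matroid_def by (metis le_neq_implies_less)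
      have finE: "finite E" by (rule finite_ground)
      have finY: "finite Y" using Y finE finite_subset by blast
      obtain F where F: "F \<subseteq> Y" "card F = r - 1"
        using obtain_subset_with_card_n[of "r - 1" Y] cY by auto
      have "F \<in> indep" using F Y pav r \<open>0 < r\<close> unfolding paving_matroid_def by auto
      then have "r - 1 \<le> matroid_rank indep Y" using card_le_rank[of F Y] F by simp
      moreover have "matroid_rank indep Y < r"
      proof (rule ccontr)
        assume "\<not> ?thesis"
        moreover obtain Z where Z: "Z \<in> indep" "Z \<subseteq> Y" "card Z = matroid_rank indep Y" by (rule rank_attained)
        ultimately have "Z = Y" using finY cY by (intro card_seteq) auto
        then show False using Z nY by simp
      qed
      ultimately have "matroid_rank indep Y + 1 = matroid_rank indep E" using r \<open>0 < r\<close> by simp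
      then obtain H where H: "Y \<subseteq> H" "matroid_hyperplane E indep H"
        using dependent_subset_hyperplane Y by metis
      have "finite H" using H(2) finE finite_subset
        by (auto simp: matroid_hyperplane_def matroid_flat_def)
      then have "r \<le> card H" using card_mono[OF _ H(1)] cY by simp
      then have "card H = b" using hyp[OF H(2)] \<open>0 < r\<close> by auto
      then show False using Y cY H by blast
    qed
  }
qed

text \<open>Sends a matroid to its set of hyperplanes of size \<open>r + k\<close>. This is
  injective by \<open>paving_indep_iff\<close>, yields packings by
  \<open>paving_hyperplane_subset\<close>, and \<open>packing_size_le\<close> limits the range of
  \<open>m\<close>.\<close>

lemma s_paving_le_sum_packings:
  assumes "0 < r"
  shows "s_paving k n r
    \<le> (\<Sum>m\<le>(n choose (r - 1)) div ((r + k) choose (r - 1)). card (packings {1..n} (r - 1) (r + k) m))"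
proof -
  let ?E = "{1..n}" and ?Q = "(r + k) choose (r - 1)"
  define P where "P = {indep. paving_matroid ?E indep \<and> matroid_rank indep ?E = r \<and>
                  (\<forall>H. matroid_hyperplane ?E indep H \<longrightarrow> card H = r - 1 \<or> card H = r + k)}"
  define blocks where "blocks = (\<lambda>indep. {H. matroid_hyperplane ?E indep H \<and> card H = r + k})"
  let ?Pk = "\<lambda>m. packings ?E (r - 1) (r + k) m"
  let ?U = "\<Union>m\<le>(n choose (r - 1)) div ?Q. ?Pk m"
  have "inj_on blocks P"
  proof (rule inj_onI, rule set_eqI)
    fix i j Y assume i: "i \<in> P" and j: "j \<in> P" and eq: "blocks i = blocks j"
    have *: "Y \<in> l \<longleftrightarrow> Y \<subseteq> ?E \<and> card Y \<le> r \<and> (card Y = r \<longrightarrow> \<not> (\<exists>H\<in>blocks l. Y \<subseteq> H))" if "l \<in> P" for l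
      using paving_indep_iff[of ?E l r "r + k" Y] that assms by (auto simp: P_def blocks_def)
    show "Y \<in> i \<longleftrightarrow> Y \<in> j" using *[OF i] *[OF j] eq by simp
  qed
  moreover have "blocks ` P \<subseteq> ?U"
  proof
    fix I assume "I \<in> blocks ` P"
    then obtain l where l: "l \<in> P" and I: "I = blocks l" by blast
    have pav: "paving_matroid ?E l" and rk: "matroid_rank l ?E = r" using l by (auto simp: P_def)
    interpret matroid ?E l using pav by (simp add: paving_matroid_def)
    have "I \<subseteq> subsets_of_card ?E (r + k)"
      by (auto simp: I blocks_def matroid_hyperplane_def matroid_flat_def)
    moreover have "card (H \<inter> H') < r - 1" if "H \<in> I" "H' \<in> I" "H \<noteq> H'" for H H'
    proof (rule ccontr)
      assume "\<not> ?thesis"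
      then have "r - 1 \<le> card (H \<inter> H')" "r - 1 \<le> card (H' \<inter> H)" by (simp_all add: Int_commute)
      then have "H \<subseteq> H'" "H' \<subseteq> H"
        using paving_hyperplane_subset[OF pav rk assms] that unfolding I blocks_def by auto
      then show False using that by simp
    qed
    ultimately have I_pack: "I \<in> ?Pk (card I)" by (auto simp: conflict_free_def not_le)
    then have "card I * ?Q \<le> n choose (r - 1)" using packing_size_le[of ?E I] by simp
    then have "card I \<le> (n choose (r - 1)) div ?Q"
      by (simp add: less_eq_div_iff_mult_less_eq)
    then show "I \<in> ?U" using I_pack by blast
  qed
  moreover have "finite ?U" by (intro finite_UN_I conflict_free_finite) auto
  ultimately have "card P \<le> card ?U" by (rule card_inj_on_le)
  also have "\<dots> \<le> (\<Sum>m\<le>(n choose (r - 1)) div ?Q. card (?Pk m))" by (rule card_UN_le) simp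
  finally show ?thesis unfolding s_paving_def P_def .
qed

section \<open>Asymptotics\<close>

text \<open>A left Riemann sum of \<open>ln\<close> over the interval from \<open>\<gamma>\<close>
  to \<open>1 + \<gamma>\<close>, bounded by the integral via the antiderivative \<open>F\<close>.
  The shift by \<open>\<gamma>\<close> keeps the term \<open>i = 0\<close> away from the
  singularity.\<close>

lemma sum_ln_le_integral:
  fixes \<gamma> :: real
  assumes "\<gamma> > 0" and "m > 0"
  shows "(\<Sum>i<m. ln (real i / real m + \<gamma>)) \<le> real m * ((1 + \<gamma>) * ln (1 + \<gamma>) - \<gamma> * ln \<gamma> - 1)"
proof -
  define F :: "real \<Rightarrow> real" where "F = (\<lambda>x. x * ln x - x)"
  define x where "x = (\<lambda>i. real i / real m + \<gamma>)"
  have "ln (x i) \<le> real m * (F (x (Suc i)) - F (x i))" for i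
  proof -
    have xpos: "x i > 0" "x (Suc i) > 0" using assms by (auto simp: x_def add_nonneg_pos)
    have step: "x (Suc i) - x i = 1 / real m" using assms by (simp add: x_def field_simps)
    \<comment> \<open>This inequality amounts to convexity of \<open>F\<close>: its increment is at
      least the step length times \<open>ln (x i)\<close>.\<close>
    have "ln (x i) - ln (x (Suc i)) \<le> x i / x (Suc i) - 1"
      using ln_le_minus_one[of "x i / x (Suc i)"] xpos by (simp add: ln_div)
    then have "x (Suc i) * (ln (x i) - ln (x (Suc i))) \<le> x i - x (Suc i)"
      using mult_left_mono[of _ _ "x (Suc i)"] xpos by (fastforce simp: right_diff_distrib)
    then have "(x (Suc i) - x i) * ln (x i) \<le> F (x (Suc i)) - F (x i)"
      by (simp add: F_def algebra_simps)
    then have "real m * (1 / real m * ln (x i)) \<le> real m * (F (x (Suc i)) - F (x i))"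
      unfolding step by (rule mult_left_mono) simp
    then show ?thesis using assms by simp
  qed
  then have "(\<Sum>i<m. ln (x i)) \<le> (\<Sum>i<m. real m * (F (x (Suc i)) - F (x i)))"
    by (intro sum_mono)
  also have "\<dots> = real m * (F (x m) - F (x 0))"
    by (simp add: sum_distrib_left[symmetric] sum_lessThan_telescope[of "\<lambda>i. F (x i)"])
  also have "F (x m) - F (x 0) = (1 + \<gamma>) * ln (1 + \<gamma>) - \<gamma> * ln \<gamma> - 1"
    using assms by (simp add: F_def x_def)
  finally show ?thesis by (simp add: x_def)
qed

lemma add_powers_le_power_add:
  fixes a c :: real
  assumes "0 \<le> a" and "0 \<le> c" and "0 < q"
  shows "a ^ q + c ^ q \<le> (a + c) ^ q"
  using \<open>0 < q\<close>
proof (induction q rule: nat_induct_non_zero)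
  case (Suc q)
  have "a ^ Suc q + c ^ Suc q \<le> (a + c) * (a ^ q + c ^ q)"
    using assms(1,2) by (simp add: algebra_simps)
  also have "\<dots> \<le> (a + c) * (a + c) ^ q"
    using Suc.IH assms(1,2) by (intro mult_left_mono) auto
  finally show ?case by simp
qed simp

text \<open>Half of \<open>\<gamma>\<close> absorbs \<open>\<eta>\<close>, by superadditivity of the
  \<open>q\<close>-th power; the other half absorbs the shift by \<open>1 / m\<close> from
  \<open>m - i\<close> to \<open>m - Suc i\<close>, after which reversing the sum gives the
  arguments \<open>i / m\<close> with \<open>i < m\<close>.\<close>

lemma sum_ln_power_add_le:
  fixes \<gamma> \<eta> :: real
  assumes "\<gamma> > 0" and "m > 0" and "q > 0" and "0 \<le> \<eta>" and "\<eta> \<le> (\<gamma> / 2) ^ q" and "1 / real m \<le> \<gamma> / 2"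
  shows "(\<Sum>i<m. ln ((real (m - i) / real m) ^ q + \<eta>))
      \<le> real m * (real q * ((1 + \<gamma>) * ln (1 + \<gamma>) - \<gamma> * ln \<gamma> - 1))"
proof -
  have "(\<Sum>i<m. ln ((real (m - i) / real m) ^ q + \<eta>))
      \<le> (\<Sum>i<m. real q * ln (real (m - Suc i) / real m + \<gamma>))"
  proof (rule sum_mono)
    fix i assume "i \<in> {..<m}"
    then have i: "i < m" by simp
    let ?y = "real (m - i) / real m" and ?z = "real (m - Suc i) / real m + \<gamma>"
    have zpos: "?z > 0" using assms(1) by (intro add_nonneg_pos) auto
    have "?y = real (m - Suc i) / real m + 1 / real m" using i by (simp add: field_simps)
    then have yz: "?y + \<gamma> / 2 \<le> ?z" using assms(6) by linarith
    have "?y ^ q + \<eta> \<le> ?y ^ q + (\<gamma> / 2) ^ q" using assms(5) by simp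
    also have "\<dots> \<le> (?y + \<gamma> / 2) ^ q" using assms by (intro add_powers_le_power_add) auto
    also have "\<dots> \<le> ?z ^ q" using assms yz by (intro power_mono) auto
    finally have "?y ^ q + \<eta> \<le> ?z ^ q" .
    moreover have "0 < ?y ^ q + \<eta>" using i assms(4) by (intro add_pos_nonneg zero_less_power) auto
    ultimately have "ln (?y ^ q + \<eta>) \<le> ln (?z ^ q)" using zpos by (intro ln_mono) auto
    then show "ln (?y ^ q + \<eta>) \<le> real q * ln ?z" using zpos by (simp add: ln_realpow)
  qed
  also have "\<dots> = real q * (\<Sum>i<m. ln (real i / real m + \<gamma>))"
    by (simp only: sum_distrib_left[symmetric] sum.nat_diff_reindex[of "\<lambda>i. ln (real i / real m + \<gamma>)"])
  also have "\<dots> \<le> real q * (real m * ((1 + \<gamma>) * ln (1 + \<gamma>) - \<gamma> * ln \<gamma> - 1))"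
    by (intro mult_left_mono sum_ln_le_integral assms) auto
  finally show ?thesis by (simp add: ac_simps)
qed

text \<open>The weak Stirling bound \<open>m! \<ge> (m / e) ^ m\<close>; the induction rests on
  \<open>m * ln (1 + 1 / m) \<le> 1\<close>.\<close>

lemma ln_fact_ge: "real m * ln (real m) - real m \<le> ln (fact m)"
proof (induction m)
  case (Suc m)
  show ?case
  proof (cases "m = 0")
    case False
    have "ln (real (Suc m)) - ln (real m) \<le> 1 / real m"
      using ln_le_minus_one[of "real (Suc m) / real m"] False by (simp add: ln_div field_simps)
    then have "real m * (ln (real (Suc m)) - ln (real m)) \<le> 1"
      using mult_left_mono[of _ "1 / real m" "real m"] False by fastforce
    moreover have "ln (fact (Suc m) :: real) = ln (real (Suc m)) + ln (fact m)"
      by (simp only: fact_Suc of_nat_mult[symmetric]) (simp add: ln_mult)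
    ultimately show ?thesis using Suc.IH by (simp add: algebra_simps)
  qed simp
qed simp

text \<open>With \<open>\<mu> = m * Q / V\<close>, the Stirling bound leaves
  \<open>V / Q * (\<mu> * ln N + \<mu> - \<mu> * ln \<mu>)\<close>, and
  \<open>\<mu> - \<mu> * ln \<mu> \<le> 1\<close>. In the application \<open>V * N / Q\<close> is
  the number of blocks.\<close>

lemma ln_power_div_fact_le:
  fixes V N Q :: real
  assumes "V > 0" and "N > 0" and "Q > 0" and "real m * Q \<le> V"
  shows "real m * ln (V * N / Q) - ln (fact m) \<le> V / Q * (real m * Q / V * ln N + 1)"
proof (cases "m = 0")
  case True
  then show ?thesis using assms by simp
next
  case False
  have "ln (V / (real m * Q)) \<le> V / (real m * Q) - 1"
    using assms False by (intro ln_le_minus_one) simp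
  then have "real m * ln (V / (real m * Q)) \<le> real m * (V / (real m * Q) - 1)"
    by (rule mult_left_mono) simp
  also have "\<dots> = V / Q - real m" using False assms by (simp add: field_simps)
  finally have 1: "real m * ln (V / (real m * Q)) \<le> V / Q - real m" .
  have "ln (V * N / Q) = ln (V / (real m * Q)) + ln (real m) + ln N"
    using assms False by (simp add: ln_div ln_mult)
  then have "real m * ln (V * N / Q) - ln (fact m)
      \<le> real m * ln (V / (real m * Q)) + real m + real m * ln N"
    using ln_fact_ge[of m] by (simp add: algebra_simps)
  also have "\<dots> \<le> V / Q + real m * ln N" using 1 by simp
  also have "\<dots> = V / Q * (real m * Q / V * ln N + 1)" using assms by (simp add: field_simps)
  finally show ?thesis .
qed

text \<open>This is the loss caused by the shift \<open>\<gamma>\<close>; its sign lets it be added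
  to bounds that hold without it.\<close>

lemma mult_ln_increment_nonneg:
  fixes \<gamma> :: real
  assumes "0 < \<gamma>" and "\<gamma> < 1"
  shows "0 \<le> (1 + \<gamma>) * ln (1 + \<gamma>) - \<gamma> * ln \<gamma>"
proof -
  have "(1 + \<gamma>) * ln (1 + \<gamma>) \<ge> 0" using assms by (intro mult_nonneg_nonneg) auto
  moreover have "\<gamma> * ln \<gamma> \<le> 0" using assms by (intro mult_nonneg_nonpos) auto
  ultimately show ?thesis by linarith
qed

text \<open>Here \<open>m * Q / V\<close> is the fraction of covered \<open>t\<close>-subsets. If it is at most
  \<open>1 - Q / ln N\<close>, the trivial bound on the number of choices suffices; otherwise almost
  every block has \<open>b choose t\<close> conflicts.\<close>

lemma card_packings_le:
  fixes n t b m :: nat and \<gamma> :: real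
  defines "Q \<equiv> real (b choose t)" and "V \<equiv> real (n choose t)" and "N \<equiv> real ((n - t) choose (b - t))"
  assumes "finite E" and n: "card E = n" and "t < b" and "b \<le> n" and mQ: "real m * Q \<le> V"
    and \<gamma>: "0 < \<gamma>" "\<gamma> < 1" and lnN: "Q < ln N"
    and cond_eta: "Q * (Q / ln N) + real (b choose Suc t) * real (b - t) / real (n - t) \<le> (\<gamma> / 2) ^ (b choose t)"
    and cond_m: "2 / \<gamma> \<le> (1 - Q / ln N) * (V / Q)"
  shows "real (card (packings E t b m))
      \<le> exp (V / Q * (ln N + 1 - Q + Q * ((1 + \<gamma>) * ln (1 + \<gamma>) - \<gamma> * ln \<gamma>)))"
proof -
  let ?X = "subsets_of_card E b" and ?\<Gamma> = "(1 + \<gamma>) * ln (1 + \<gamma>) - \<gamma> * ln \<gamma>"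
  have Qpos: "Q > 0" and Vpos: "V > 0" and Npos: "N > 0"
    using assms(6,7) by (simp_all add: Q_def V_def N_def)
  have finX: "finite ?X" using assms(4) by simp
  have cX: "card ?X = n choose b" using assms(4) n by (simp add: n_subsets)
  then have neX: "?X \<noteq> {}" using assms(7) by (metis card.empty less_nat_zero_code zero_less_binomial)
  have refl: "t \<le> card (B \<inter> B)" if "B \<in> ?X" for B using that assms(6) by simp
  have "(n choose b) * (b choose t) = (n choose t) * ((n - t) choose (b - t))"
    using choose_mult[of t b n] assms(6,7) by simp
  then have "real (n choose b) * Q = V * N" unfolding Q_def V_def N_def by (metis of_nat_mult)
  then have X: "real (card ?X) = V * N / Q" using Qpos cX by (simp add: field_simps)
  define \<mu> where "\<mu> = real m * Q / V"
  have \<mu>: "0 \<le> \<mu>" "\<mu> \<le> 1" using mQ Vpos Qpos by (simp_all add: \<mu>_def)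
  have base: "real m * ln (real (card ?X)) - ln (fact m) \<le> V / Q * (\<mu> * ln N + 1)"
    unfolding X \<mu>_def by (rule ln_power_div_fact_le[OF Vpos Npos Qpos mQ])
  have lnpos: "ln N > 0" using lnN Qpos by simp
  have \<Gamma>: "?\<Gamma> \<ge> 0" using mult_ln_increment_nonneg[OF \<gamma>] .
  show ?thesis
  proof (cases "\<mu> \<le> 1 - Q / ln N")
    case True
    \<comment> \<open>Exponent 0 and \<open>\<eta> = 0\<close> make all logarithms in the sum
      vanish, leaving the trivial bound.\<close>
    have "real (card (packings E t b m))
      \<le> exp (real m * ln (real (card ?X)) + (\<Sum>i<m. ln ((real (m - i) / real m) ^ 0 + 0)) - ln (fact m))"
      by (rule card_conflict_free_le_exp) (use finX neX refl in auto)
    also have "\<dots> \<le> exp (V / Q * (\<mu> * ln N + 1))" using base by simp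
    also have "\<dots> \<le> exp (V / Q * (ln N + 1 - Q + Q * ?\<Gamma>))"
    proof -
      \<comment> \<open>The threshold for \<open>\<mu>\<close> is chosen so that its distance from 1
        gains exactly \<open>Q\<close> here.\<close>
      have "\<mu> * ln N \<le> (1 - Q / ln N) * ln N" using True lnpos by (intro mult_right_mono) auto
      also have "\<dots> = ln N - Q" using lnpos by (simp add: field_simps)
      finally have "\<mu> * ln N + 1 \<le> ln N + 1 - Q + Q * ?\<Gamma>"
        using mult_nonneg_nonneg[of Q ?\<Gamma>] Qpos \<Gamma> by linarith
      then show ?thesis using Qpos Vpos by (simp add: mult_left_mono divide_right_mono)
    qed
    finally show ?thesis .
  next
    case False
    define \<eta> where "\<eta> = Q * (1 - \<mu>) + real (b choose Suc t) * real (b - t) / real (n - t)"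
    have \<eta>0: "\<eta> \<ge> 0" unfolding \<eta>_def using \<mu> Qpos by (intro add_nonneg_nonneg) auto
    have "Q * (1 - \<mu>) \<le> Q * (Q / ln N)" using False Qpos by (intro mult_left_mono) auto
    then have \<eta>1: "\<eta> \<le> (\<gamma> / 2) ^ (b choose t)" using cond_eta by (simp add: \<eta>_def)
    have "(1 - Q / ln N) * (V / Q) \<le> \<mu> * (V / Q)" using False Qpos Vpos by (intro mult_right_mono) auto
    also have "\<dots> = real m" using Qpos Vpos by (simp add: \<mu>_def)
    \<comment> \<open>The packing must be large for the Riemann sum to be accurate:
      \<open>cond_m\<close> yields \<open>1 / m \<le> \<gamma> / 2\<close>.\<close>
    finally have m2: "2 / \<gamma> \<le> real m" using cond_m by linarith
    then have mpos: "m > 0" using \<gamma> by (metis divide_pos_pos not_gr0 of_nat_0 leD zero_less_numeral)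
    have m\<gamma>: "1 / real m \<le> \<gamma> / 2" using m2 mpos \<gamma> by (simp add: field_simps)
    have "real (card (packings E t b m))
      \<le> exp (real m * ln (real (card ?X))
          + (\<Sum>i<m. ln ((real (m - i) / real m) ^ (b choose t) + \<eta>)) - ln (fact m))"
    proof (rule card_conflict_free_le_exp)
      fix I assume "I \<in> packings E t b m"
      then show "real (card {B \<in> ?X. card {B' \<in> I. t \<le> card (B \<inter> B')} < b choose t}) \<le> \<eta> * real (card ?X)"
        using few_conflicts_fraction_le[OF assms(4) n assms(6,7)]
        unfolding \<eta>_def \<mu>_def Q_def V_def by blast
    qed (use finX neX refl \<eta>0 in auto)
    also have "\<dots> \<le> exp (V / Q * (ln N + 1 - Q + Q * ?\<Gamma>))"
    proof -
      have "(\<Sum>i<m. ln ((real (m - i) / real m) ^ (b choose t) + \<eta>)) \<le> real m * (Q * (?\<Gamma> - 1))"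
        unfolding Q_def using assms(6) by (intro sum_ln_power_add_le \<gamma> mpos \<eta>0 \<eta>1 m\<gamma>) simp
      also have "real m * (Q * (?\<Gamma> - 1)) = V / Q * (\<mu> * (Q * (?\<Gamma> - 1)))"
        using Qpos Vpos by (simp add: \<mu>_def)
      finally have "real m * ln (real (card ?X))
          + (\<Sum>i<m. ln ((real (m - i) / real m) ^ (b choose t) + \<eta>)) - ln (fact m)
        \<le> V / Q * (\<mu> * ln N + 1) + V / Q * (\<mu> * (Q * (?\<Gamma> - 1)))"
        using base by linarith
      also have "\<dots> = V / Q * (\<mu> * (ln N + Q * (?\<Gamma> - 1)) + 1)" by (simp add: algebra_simps)
      also have "\<dots> \<le> V / Q * (1 * (ln N + Q * (?\<Gamma> - 1)) + 1)"
      proof -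
        \<comment> \<open>The coefficient of \<open>\<mu>\<close> is nonnegative because
          \<open>Q < ln N\<close>, so \<open>\<mu>\<close> may be replaced by 1.\<close>
        have "ln N + Q * (?\<Gamma> - 1) \<ge> 0"
          unfolding right_diff_distrib[of Q ?\<Gamma> 1]
          using lnN mult_nonneg_nonneg[of Q ?\<Gamma>] Qpos \<Gamma> by linarith
        then show ?thesis
          using \<mu> Qpos Vpos by (intro mult_left_mono add_right_mono mult_right_mono) auto
      qed
      also have "\<dots> = V / Q * (ln N + 1 - Q + Q * ?\<Gamma>)" by (simp add: algebra_simps)
      finally show ?thesis by simp
    qed
    finally show ?thesis .
  qed
qed

text \<open>There are at most \<open>V + 1\<close> possible packing sizes, and each contributes at
  most \<open>exp L\<close> by the bound uniform in \<open>m\<close>.\<close>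

lemma ln_s_paving_le:
  fixes n r k :: nat and \<gamma> :: real
  defines "t \<equiv> r - 1" and "b \<equiv> r + k"
  defines "Q \<equiv> real (b choose t)" and "V \<equiv> real (n choose t)" and "N \<equiv> real ((n - t) choose (b - t))"
  assumes "0 < r" and "b \<le> n" and \<gamma>: "0 < \<gamma>" "\<gamma> < 1" and lnN: "Q < ln N"
    and cond_eta: "Q * (Q / ln N) + real (b choose Suc t) * real (b - t) / real (n - t) \<le> (\<gamma> / 2) ^ (b choose t)"
    and cond_m: "2 / \<gamma> \<le> (1 - Q / ln N) * (V / Q)"
  shows "ln (real (s_paving k n r))
      \<le> ln (V + 1) + V / Q * (ln N + 1 - Q + Q * ((1 + \<gamma>) * ln (1 + \<gamma>) - \<gamma> * ln \<gamma>))"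
proof -
  define L where "L = V / Q * (ln N + 1 - Q + Q * ((1 + \<gamma>) * ln (1 + \<gamma>) - \<gamma> * ln \<gamma>))"
  have tb: "t < b" using assms(6) by (simp add: t_def b_def)
  have Qpos: "Q > 0" using tb by (simp add: Q_def)
  let ?q = "(n choose t) div (b choose t)"
  have "real (card (packings {1..n} t b m)) \<le> exp L" if "m \<le> ?q" for m
  proof -
    have "m * (b choose t) \<le> n choose t"
      using that tb by (simp add: less_eq_div_iff_mult_less_eq)
    then have "real m * Q \<le> V" unfolding Q_def V_def by (metis of_nat_mult of_nat_le_iff)
    then show ?thesis
      unfolding L_def Q_def V_def N_def
      by (intro card_packings_le) (use tb assms in auto)
  qed
  then have "(\<Sum>m\<le>?q. real (card (packings {1..n} t b m))) \<le> real (card {..?q}) * exp L"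
    by (intro sum_bounded_above) auto
  moreover have "real (s_paving k n r) \<le> (\<Sum>m\<le>?q. real (card (packings {1..n} t b m)))"
    using s_paving_le_sum_packings[OF assms(6), of k n] unfolding t_def b_def
    by (simp only: of_nat_sum[symmetric] of_nat_le_iff)
  moreover have "real (card {..?q}) * exp L \<le> (V + 1) * exp L"
    by (intro mult_right_mono) (simp_all add: V_def)
  ultimately have s: "real (s_paving k n r) \<le> (V + 1) * exp L" by linarith
  have Vnn: "V + 1 \<ge> 1" by (simp add: V_def)
  have "ln (real (s_paving k n r)) \<le> ln ((V + 1) * exp L)"
  proof (cases "s_paving k n r = 0")
    \<comment> \<open>\<open>ln 0\<close> is 0 here, so the right-hand side must be shown
      nonnegative.\<close>
    case True
    then have "ln (real (s_paving k n r)) = 0" by simp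
    also have "0 \<le> ln ((V + 1) * exp L)"
    proof -
      have "0 \<le> L"
      proof -
        have "0 \<le> Q * ((1 + \<gamma>) * ln (1 + \<gamma>) - \<gamma> * ln \<gamma>)"
          using Qpos mult_ln_increment_nonneg[OF \<gamma>] by (intro mult_nonneg_nonneg) auto
        then show ?thesis unfolding L_def
          using lnN Qpos by (intro mult_nonneg_nonneg) (auto simp: V_def)
      qed
      then show ?thesis using Vnn by (simp add: ln_mult)
    qed
    finally show ?thesis .
  next
    case False
    then show ?thesis using s Vnn by (intro ln_mono) auto
  qed
  also have "\<dots> = ln (V + 1) + L" using Vnn by (simp add: ln_mult)
  finally show ?thesis unfolding L_def .
qed

section \<open>Passage to the limit in \<open>n\<close>\<close>

lemma filterlim_binomial_at_top:
  assumes "0 < j"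
  shows "filterlim (\<lambda>n. real (n choose j)) at_top sequentially"
proof (rule filterlim_at_top_mono)
  show "filterlim (\<lambda>n. real n / real j) at_top sequentially"
    using assms by real_asymp
  have "real n / real j \<le> real (n choose j)" if "j \<le> n" for n
  proof -
    have "(real n / real j) ^ 1 \<le> (real n / real j) ^ j"
      using that assms by (intro power_increasing) auto
    also have "\<dots> \<le> real (n choose j)" using binomial_ge_n_over_k_pow_k[OF that, where 'a = real] .
    finally show ?thesis by simp
  qed
  then show "\<forall>\<^sub>F n in sequentially. real n / real j \<le> real (n choose j)"
    using eventually_ge_at_top[of j] by (rule eventually_mono[rotated])
qed

theorem theorem4:
  fixes r k :: nat
  assumes "r \<ge> 3"
  defines "Q \<equiv> real ((r + k) choose (k + 1))"
  defines "N \<equiv> (\<lambda>n::nat. real ((n - r + 1) choose (k + 1)))"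
  shows "\<exists>\<epsilon>::nat \<Rightarrow> real. \<epsilon> \<in> o(\<lambda>_. 1) \<and>
           (\<forall>\<^sub>F n in sequentially.
              ln (real (s_paving k n r))
                \<le> inverse Q * real (n choose (r - 1)) * (ln (N n) + 1 - Q + \<epsilon> n))"
proof -
  define t where "t = r - 1"
  define b where "b = r + k"
  define V where "V = (\<lambda>n. real (n choose t))"
  have bt: "b - t = k + 1" "t < b" "0 < t" "0 < r" using assms(1) by (simp_all add: t_def b_def)
  have Q: "real (b choose t) = Q"
    unfolding Q_def b_def[symmetric]
    using binomial_symmetric[OF less_imp_le[OF bt(2)]] by (simp only: bt(1))
  have Qpos: "Q > 0" using bt(4) by (simp add: Q_def)
  \<comment> \<open>Truncated subtraction: below \<open>r\<close> the upper indices
    \<open>n - r + 1\<close> and \<open>n - t\<close> differ.\<close>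
  have N_eq: "N n = real ((n - t) choose (b - t))" if "n \<ge> r" for n
  proof -
    have "n - r + 1 = n - t" using that assms(1) by (simp add: t_def)
    then show ?thesis by (simp only: N_def bt(1))
  qed
  have V_lim: "filterlim V at_top sequentially"
    unfolding V_def by (rule filterlim_binomial_at_top[OF bt(3)])
  have N_lim: "filterlim N at_top sequentially"
  proof -
    have "filterlim (\<lambda>n. n - r + 1) at_top sequentially" by real_asymp
    then show ?thesis unfolding N_def
      by (rule filterlim_compose[OF filterlim_binomial_at_top, rotated]) simp
  qed
  have lnN_lim: "filterlim (\<lambda>n. ln (N n)) at_top sequentially"
    by (rule filterlim_compose[OF ln_at_top N_lim])
  have QlnN: "((\<lambda>n. Q / ln (N n)) \<longlongrightarrow> 0) sequentially"
    by (rule real_tendsto_divide_at_top[OF tendsto_const lnN_lim])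
  \<comment> \<open>The least nonnegative error for which the claimed inequality holds when
    \<open>V n > 0\<close>; it remains to show that it tends to 0.\<close>
  define \<epsilon> where "\<epsilon> = (\<lambda>n. max 0 (Q / V n * ln (real (s_paving k n r)) - (ln (N n) + 1 - Q)))"
  have small: "\<forall>\<^sub>F n in sequentially. \<epsilon> n < e" if e: "e > 0" for e
  proof -
    \<comment> \<open>\<open>\<gamma>\<close> is fixed before \<open>n\<close> grows: its loss takes
      up half of \<open>e\<close>, and the remaining conditions hold eventually for this
      \<open>\<gamma>\<close>.\<close>
    have "((\<lambda>x::real. Q * ((1 + x) * ln (1 + x) - x * ln x)) \<longlongrightarrow> 0) (at_right 0)"
      by real_asymp
    then have "\<forall>\<^sub>F x in at_right 0. Q * ((1 + x) * ln (1 + x) - x * ln x) < e / 2"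
      using e by (intro order_tendstoD) auto
    moreover have "\<forall>\<^sub>F x::real in at_right 0. 0 < x \<and> x < 1"
      by (auto simp: eventually_at_right_field intro!: exI[of _ 1])
    ultimately have "\<exists>x::real. Q * ((1 + x) * ln (1 + x) - x * ln x) < e / 2 \<and> 0 < x \<and> x < 1"
      by (rule eventually_happens'[OF trivial_limit_at_right_real eventually_conj])
    then obtain \<gamma> :: real
      where \<gamma>: "0 < \<gamma>" "\<gamma> < 1" and \<gamma>e: "Q * ((1 + \<gamma>) * ln (1 + \<gamma>) - \<gamma> * ln \<gamma>) < e / 2" by blast
    have ev1: "\<forall>\<^sub>F n in sequentially. Q < ln (N n)"
      using lnN_lim by (simp add: filterlim_at_top_dense)
    have ev2: "\<forall>\<^sub>F n in sequentially.
        Q * (Q / ln (N n)) + real (b choose Suc t) * real (b - t) / real (n - t) < (\<gamma> / 2) ^ (b choose t)"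
    proof (rule order_tendstoD(2))
      have "((\<lambda>n. real (b choose Suc t) * real (b - t) / real (n - t)) \<longlongrightarrow> 0) sequentially"
        by real_asymp
      from tendsto_add[OF tendsto_mult[OF tendsto_const[of Q] QlnN] this]
      show "((\<lambda>n. Q * (Q / ln (N n)) + real (b choose Suc t) * real (b - t) / real (n - t)) \<longlongrightarrow> 0) sequentially"
        by simp
      show "0 < (\<gamma> / 2) ^ (b choose t)" using \<gamma> by simp
    qed
    have ev3: "\<forall>\<^sub>F n in sequentially. 2 / \<gamma> \<le> (1 - Q / ln (N n)) * (V n / Q)"
    proof -
      have "((\<lambda>n. 1 - Q / ln (N n)) \<longlongrightarrow> 1 - 0) sequentially"
        by (intro tendsto_diff tendsto_const QlnN)
      moreover have "filterlim (\<lambda>n. V n / Q) at_top sequentially"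
        using filterlim_tendsto_pos_mult_at_top[OF tendsto_const[of "1 / Q"] _ V_lim] Qpos by simp
      ultimately have "filterlim (\<lambda>n. (1 - Q / ln (N n)) * (V n / Q)) at_top sequentially"
        by (intro filterlim_tendsto_pos_mult_at_top[where c = "1 - 0"]) auto
      then show ?thesis by (simp add: filterlim_at_top)
    qed
    \<comment> \<open>The factor \<open>V + 1\<close> for the number of packing sizes uses up the
      other half of \<open>e\<close>.\<close>
    have ev4: "\<forall>\<^sub>F n in sequentially. Q * (ln (V n + 1) / V n) < e / 2"
    proof (rule order_tendstoD(2))
      have "((\<lambda>x::real. Q * (ln (x + 1) / x)) \<longlongrightarrow> 0) at_top" by real_asymp
      from filterlim_compose[OF this V_lim]
      show "((\<lambda>n. Q * (ln (V n + 1) / V n)) \<longlongrightarrow> 0) sequentially" .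
      show "0 < e / 2" using e by simp
    qed
    have ev5: "\<forall>\<^sub>F n in sequentially. b \<le> n" by (rule eventually_ge_at_top)
    have ev6: "\<forall>\<^sub>F n in sequentially. 0 < V n"
      using V_lim by (simp add: filterlim_at_top_dense)
    from ev1 ev2 ev3 ev4 ev5 ev6 show ?thesis
    proof eventually_elim
      case (elim n)
      define G where "G = Q * ((1 + \<gamma>) * ln (1 + \<gamma>) - \<gamma> * ln \<gamma>)"
      have "n \<ge> r" using elim(5) by (simp add: b_def)
      note Nn = N_eq[OF this]
      have "ln (real (s_paving k n r)) \<le> ln (V n + 1) + V n / Q * (ln (N n) + 1 - Q + G)"
        using ln_s_paving_le[of r k n \<gamma>, folded t_def b_def, unfolded Q, folded Nn V_def] elim \<gamma> bt(4)
        unfolding V_def G_def by auto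
      then have "Q / V n * ln (real (s_paving k n r))
          \<le> Q / V n * (ln (V n + 1) + V n / Q * (ln (N n) + 1 - Q + G))"
        using Qpos elim(6) by (intro mult_left_mono) auto
      also have "\<dots> = Q * (ln (V n + 1) / V n) + (ln (N n) + 1 - Q + G)"
        using Qpos elim(6) by (simp add: distrib_left)
      finally have "Q / V n * ln (real (s_paving k n r)) - (ln (N n) + 1 - Q) < e"
        using elim(4) \<gamma>e unfolding G_def by linarith
      then show ?case using e by (simp add: \<epsilon>_def)
    qed
  qed
  have "\<epsilon> \<longlonglongrightarrow> 0"
  proof (rule order_tendstoI)
    fix a :: real assume "a < 0"
    then show "\<forall>\<^sub>F n in sequentially. a < \<epsilon> n" by (auto simp: \<epsilon>_def less_max_iff_disj)
  qed (rule small)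
  then have "\<epsilon> \<in> o(\<lambda>_. 1)" by (intro smalloI_tendsto) auto
  moreover have "\<forall>\<^sub>F n in sequentially. ln (real (s_paving k n r))
      \<le> inverse Q * real (n choose (r - 1)) * (ln (N n) + 1 - Q + \<epsilon> n)"
  proof -
    have "\<forall>\<^sub>F n in sequentially. 0 < V n" using V_lim by (simp add: filterlim_at_top_dense)
    then show ?thesis
    proof eventually_elim
      case (elim n)
      have "Q / V n * ln (real (s_paving k n r)) \<le> ln (N n) + 1 - Q + \<epsilon> n"
        by (simp add: \<epsilon>_def)
      then have "inverse Q * V n * (Q / V n * ln (real (s_paving k n r)))
          \<le> inverse Q * V n * (ln (N n) + 1 - Q + \<epsilon> n)"
        using elim Qpos by (intro mult_left_mono) auto
      moreover have "inverse Q * V n * (Q / V n * x) = x" for x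
        using elim Qpos by (simp add: field_simps)
      ultimately show ?case by (simp only: V_def t_def)
    qed
  qed
  ultimately show ?thesis by blast
qed

end
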